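(* Fix a non-zero integer $b$, positive integers $A_1,\dots,A_r$ (with $r\ge 1$), and a positive integer $d$. Consider the equation $$b\, n_1!!\,A_1^{n_1}\cdots n_r!!\,A_r^{n_r}=x^d$$ in unknowns $x\in\mathbb{Z}$ and positive integers $n_1,\dots,n_r$. If $d>r$, the equation has only finitely many solutions $(x,n_1,\dots,n_r)$. If $d\le r$, the equation has infinitely many solutions $(x,n_1,\dots,n_r)$, except when $b<0$ and $d$ is even, in which case it has no solutions.
   Context: For a positive integer $m$, the double factorial $m!!$ is the product of all positive integers $\le m$ having the same parity as $m$, i.e. $m!!=m(m-2)(m-4)\cdots$, ending in $1$ if $m$ is odd and in $2$ if $m$ is even. *)

theory Defs
  imports Main "HOL-Library.FuncSet"
begin

definition double_fact :: "nat \<Rightarrow> nat" where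
  "double_fact m = \<Prod>{k \<in> {1..m}. even k \<longleftrightarrow> even m}"

text \<open>
  A tuple \<open>(n\<^sub>1, \<dots>, n\<^sub>r)\<close> of positive integers is an extensional function on \<open>{1..r}\<close>
  (it is \<^term>\<open>undefined\<close> outside), so distinct elements of the solution set are distinct tuples
  and finiteness of the set counts actual solutions. The numbers \<open>A\<^sub>i\<close> are the values of \<open>A\<close> on
  \<open>{1..r}\<close>; other values of \<open>A\<close> are irrelevant.
\<close>

definition solutions :: "int \<Rightarrow> nat \<Rightarrow> (nat \<Rightarrow> nat) \<Rightarrow> nat \<Rightarrow> (int \<times> (nat \<Rightarrow> nat)) set" where
  "solutions b r A d =
     {(x, n). n \<in> {1..r} \<rightarrow>\<^sub>E {1..} \<and>
       b * (\<Prod>i = 1..r. int (double_fact (n i)) * int (A i) ^ n i) = x ^ d}"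

end

theory Submission
  imports Defs "HOL-Computational_Algebra.Computational_Algebra" "HOL-Real_Asymp.Real_Asymp"
begin

text \<open>
  If \<open>x\<close> is the largest of the numbers \<open>n\<^sub>i\<close> (\<open>n\<^sub>i\<close> odd) and \<open>n\<^sub>i / 2\<close> (\<open>n\<^sub>i\<close> even), then a prime
  \<open>p\<close> with \<open>x / 2 < p \<le> x\<close> divides every \<open>n\<^sub>i!!\<close> at most once and some \<open>n\<^sub>i!!\<close> exactly once.
  For large \<open>x\<close> such a \<open>p\<close> exists (Bertrand's postulate, by Erdos's argument) and divides neither \<open>b\<close>
  nor the \<open>A\<^sub>i\<close>, so its exponent on the left-hand side lies between \<open>1\<close> and \<open>r\<close> and cannot be
  divisible by \<open>d > r\<close>.

  For \<open>d \<le> r\<close> put \<open>n\<^sub>1 = N\<close>, \<open>n\<^sub>2 = \<dots> = n\<^sub>d = N - 2\<close> and \<open>n\<^sub>i = 1\<close> for \<open>i > d\<close>. As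
  \<open>N!! = N \<cdot> (N - 2)!!\<close>, the product of double factorials is \<open>N\<close> times a \<open>d\<close>-th power, and \<open>N\<close> can
  be chosen as a multiple of \<open>d\<close> that turns the remaining factors into a \<open>d\<close>-th power as well.
\<close>

section \<open>Legendre's formula and prime exponents in the central binomial coefficient\<close>

lemma multiplicity_eq_card_power_dvd:
  fixes p n :: nat
  assumes "prime p" "n > 0" "n \<le> k"
  shows "multiplicity p n = card {i \<in> {1..k}. p ^ i dvd n}"
proof -
  have iff: "p ^ i dvd n \<longleftrightarrow> i \<le> multiplicity p n" for i
    using assms by (intro power_dvd_iff_le_multiplicity) auto
  \<comment> \<open>The range \<open>{1..k}\<close> cuts off no exponent, since
    \<open>multiplicity p n < p ^ multiplicity p n \<le> n \<le> k\<close>.\<close>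
  have "p ^ multiplicity p n \<le> n"
    using assms by (intro dvd_imp_le multiplicity_dvd) auto
  moreover have "multiplicity p n < p ^ multiplicity p n"
    using assms prime_gt_1_nat by (intro power_gt_expt) auto
  ultimately have "{i \<in> {1..k}. p ^ i dvd n} = {1..multiplicity p n}"
    using assms(3) by (auto simp: iff)
  then show ?thesis by simp
qed

text \<open>Passing from \<open>n\<close> to \<open>Suc n\<close> raises \<open>n div p ^ i\<close>
  by one exactly when \<open>p ^ i\<close> divides \<open>Suc n\<close>. The upper limit
  \<open>k\<close> is kept apart from \<open>n\<close> so that \<open>n!\<close> and
  \<open>(2 * n)!\<close> can be expanded over the same range.\<close>

lemma legendre_formula:
  fixes p n :: nat
  assumes "prime p" "n \<le> k"
  shows "multiplicity p (fact n :: nat) = (\<Sum>i=1..k. n div p ^ i)"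
  using assms(2)
proof (induction n)
  case (Suc n)
  have "multiplicity p (fact (Suc n) :: nat) = multiplicity p (Suc n) + multiplicity p (fact n :: nat)"
    using assms(1) unfolding fact_Suc of_nat_id
    by (intro prime_elem_multiplicity_mult_distrib) auto
  also have "multiplicity p (Suc n) = (\<Sum>i=1..k. if p ^ i dvd Suc n then 1 else 0)"
    using multiplicity_eq_card_power_dvd[OF assms(1) _ Suc.prems] by (simp add: sum.If_cases Int_def)
  also have "multiplicity p (fact n :: nat) = (\<Sum>i=1..k. n div p ^ i)"
    using Suc by simp
  finally show ?case
    by (simp add: div_Suc mod_eq_0_iff_dvd flip: sum.distrib) (auto intro!: sum.cong simp: dvd_eq_mod_eq_0)
qed simp

lemma double_div_le: "2 * (n div q) \<le> 2 * n div (q::nat)"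
  by (cases "q = 0") (auto simp: less_eq_div_iff_mult_less_eq)

lemma double_div_diff_le: "2 * n div q - 2 * (n div q) \<le> (if q \<le> 2 * n then 1 else (0::nat))"
proof -
  have "2 * n div q < 2 * (n div q) + 2" if "q > 0"
    using that dividend_less_div_times[of q n] by (simp add: div_less_iff_less_mult algebra_simps)
  then show ?thesis by (cases "q = 0") auto
qed

lemma multiplicity_central_binomial:
  fixes p n :: nat
  assumes "prime p"
  shows "multiplicity p ((2 * n) choose n) = (\<Sum>i=1..2*n. 2 * n div p ^ i - 2 * (n div p ^ i))"
proof -
  let ?C = "(2 * n) choose n"
  have "fact (2 * n) = fact n * fact n * ?C"
    using binomial_fact_lemma[of n "2 * n"] by (simp add: mult_2)
  then have "multiplicity p (fact (2 * n) :: nat) = 2 * multiplicity p (fact n :: nat) + multiplicity p ?C"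
    using assms by (simp add: prime_elem_multiplicity_mult_distrib)
  then have "multiplicity p ?C = (\<Sum>i=1..2*n. 2 * n div p ^ i) - (\<Sum>i=1..2*n. 2 * (n div p ^ i))"
    using legendre_formula[OF assms, of "2 * n" "2 * n"] legendre_formula[OF assms, of n "2 * n"]
    by (simp add: sum_distrib_left)
  \<comment> \<open>Truncated subtraction may be done termwise because no subtrahend exceeds its
    minuend.\<close>
  also have "\<dots> = (\<Sum>i=1..2*n. 2 * n div p ^ i - 2 * (n div p ^ i))"
    by (intro sum_subtractf_nat[symmetric]) (rule double_div_le)
  finally show ?thesis .
qed

text \<open>Each summand of the exponent is at most 1 and vanishes once
  \<open>p ^ i > 2 * n\<close>, so the exponent is at most the number of \<open>i \<ge> 1\<close>
  with \<open>p ^ i \<le> 2 * n\<close>.\<close>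

lemma power_multiplicity_central_binomial_le:
  fixes p n :: nat
  assumes "prime p" "n > 0"
  shows "p ^ multiplicity p ((2 * n) choose n) \<le> 2 * n"
proof (rule ccontr)
  let ?L = "multiplicity p ((2 * n) choose n)"
  assume "\<not> ?thesis"
  then have gt: "2 * n < p ^ ?L" by simp
  have "?L \<le> (\<Sum>i=1..2*n. if p ^ i \<le> 2 * n then 1 else 0)"
    unfolding multiplicity_central_binomial[OF assms(1)] by (intro sum_mono double_div_diff_le)
  also have "\<dots> = card {i \<in> {1..2*n}. p ^ i \<le> 2 * n}"
    by (simp add: sum.If_cases Int_def)
  also have "\<dots> \<le> card {1..<?L}"
  proof (intro card_mono subsetI)
    fix i assume i: "i \<in> {i \<in> {1..2*n}. p ^ i \<le> 2 * n}"
    then have "p ^ i < p ^ ?L" using gt by simp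
    then have "i < ?L" using assms(1) prime_gt_1_nat power_less_imp_less_exp by blast
    then show "i \<in> {1..<?L}" using i by simp
  qed simp
  \<comment> \<open>The chain gives \<open>?L \<le> ?L - 1\<close>, which in truncated arithmetic
    leaves only 0; then \<open>gt\<close> would say \<open>2 * n < 1\<close>.\<close>
  finally have "?L = 0" by simp
  then show False using gt assms(2) by simp
qed

text \<open>The term for \<open>i = 1\<close> is \<open>2 - 2 * 1\<close>, and the higher terms
  vanish because \<open>p ^ 2 \<ge> 3 * p > 2 * n\<close>.\<close>

lemma multiplicity_central_binomial_eq_0:
  fixes p n :: nat
  assumes "prime p" "p \<le> n" "2 * n < 3 * p" "p \<ge> 3"
  shows "multiplicity p ((2 * n) choose n) = 0"
proof -
  have "2 * n div p ^ i - 2 * (n div p ^ i) = 0" if "i \<ge> 1" for i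
  proof (cases "i = 1")
    case True
    have "2 * n div p < 3" "1 \<le> n div p"
      using assms by (auto simp: div_less_iff_less_mult less_eq_div_iff_mult_less_eq)
    then show ?thesis using True by simp
  next
    case False
    have "2 * n < 3 * p" by fact
    also have "\<dots> \<le> p ^ 2" using assms(4) by (simp add: power2_eq_square)
    also have "\<dots> \<le> p ^ i" using False that assms(4) by (intro power_increasing) auto
    finally show ?thesis by simp
  qed
  then show ?thesis by (simp add: multiplicity_central_binomial[OF assms(1)])
qed

section \<open>Product of the primes up to n\<close>

lemma prod_primes_dvd:
  fixes m :: nat
  assumes "finite P" "\<And>p. p \<in> P \<Longrightarrow> prime p" "\<And>p. p \<in> P \<Longrightarrow> p dvd m"
  shows "\<Prod>P dvd m"
  using assms
proof (induction P rule: finite_induct)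
  case (insert p P)
  have "coprime p (\<Prod>P)"
    using insert by (intro prod_coprime_right primes_coprime) auto
  then show ?case using insert by (simp add: divides_mult)
qed simp

text \<open>Strong induction: an even \<open>n > 2\<close> is not prime and reduces to
  \<open>n - 1\<close>; for \<open>n = 2 * m + 1\<close> the primes above \<open>m + 1\<close> all
  divide \<open>n choose m\<close>, which is at most \<open>4 ^ m\<close>.\<close>

lemma primorial_le: "\<Prod>{p. prime p \<and> p \<le> n} \<le> (4::nat) ^ n"
proof (induction n rule: less_induct)
  case (less n)
  let ?P = "\<lambda>n. {p::nat. prime p \<and> p \<le> n}"
  consider "n \<le> 1" | "n = 2" | "n > 2" "even n" | m where "n = 2 * m + 1" "m > 0"
  proof -
    have "n \<le> 1 \<or> n = 2 \<or> (n > 2 \<and> even n) \<or> (\<exists>m. n = 2 * m + 1 \<and> m > 0)"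
      by presburger
    then show ?thesis using that by blast
  qed
  then show ?case
  proof cases
    case 1
    have "\<not> (prime p \<and> p \<le> n)" for p
      using 1 prime_gt_1_nat[of p] by auto
    then have "?P n = {}" by simp
    then show ?thesis by (simp only: prod.empty one_le_power)
  next
    case 2
    have "prime p \<and> p \<le> n \<longleftrightarrow> p = 2" for p
      using 2 prime_ge_2_nat[of p] by auto
    then have "?P n = {2}" by simp
    then have "\<Prod>(?P n) = \<Prod>{2}" by (simp only:)
    then show ?thesis using 2 by simp
  next
    case 3
    then have "\<not> prime n" using primes_dvd_imp_eq[of 2 n] by auto
    then have "prime p \<and> p \<le> n \<longleftrightarrow> prime p \<and> p \<le> n - 1" for p
      by (cases "p = n") auto
    then have "?P n = ?P (n - 1)" by simp
    then have "\<Prod>(?P n) \<le> 4 ^ (n - 1)" using less 3 by simp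
    also have "\<dots> \<le> 4 ^ n" by (intro power_increasing) auto
    finally show ?thesis .
  next
    case 4
    let ?Q = "{p. prime p \<and> m + 1 < p \<and> p \<le> n}"
    have fin: "finite (?P (m + 1))" "finite ?Q" by (auto intro: finite_subset[of _ "{..n+1}"])
    have split: "?P n = ?P (m + 1) \<union> ?Q" using 4 by auto
    have "\<Prod>(?P n) = \<Prod>(?P (m + 1)) * \<Prod>?Q"
      unfolding split using fin by (intro prod.union_disjoint) auto
    also have "\<Prod>(?P (m + 1)) \<le> 4 ^ (m + 1)" using less[of "m + 1"] 4 by simp
    also have "\<Prod>?Q \<le> n choose m"
    proof (intro dvd_imp_le prod_primes_dvd fin)
      fix p assume p: "p \<in> ?Q"
      \<comment> \<open>As \<open>m + 1 < p \<le> n\<close>, the prime divides \<open>n!\<close> but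
        neither \<open>m!\<close> nor \<open>(m + 1)!\<close>.\<close>
      have "p dvd fact n" using p by (simp add: prime_dvd_fact_iff)
      also have "fact n = fact m * fact (m + 1) * (n choose m)"
        using binomial_fact_lemma[of m n] 4 by (simp add: mult.assoc)
      finally show "p dvd n choose m"
        using p by (simp add: prime_dvd_mult_iff prime_dvd_fact_iff del: fact_Suc)
    qed (use 4 in auto)
    also have "n choose m \<le> 4 ^ m"
    proof -
      \<comment> \<open>The two equal middle entries of row \<open>n\<close> together are at most
        the row sum \<open>2 ^ n = 2 * 4 ^ m\<close>.\<close>
      have "2 * (n choose m) = (\<Sum>k\<in>{m, m + 1}. n choose k)"
        using binomial_symmetric[of m n] 4 by simp
      also have "\<dots> \<le> (\<Sum>k\<le>n. n choose k)" using 4 by (intro sum_mono2) auto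
      also have "\<dots> = 2 * 4 ^ m" unfolding choose_row_sum using 4 by (simp add: power_mult)
      finally show ?thesis by simp
    qed
    finally show ?thesis using 4 by (simp add: power_add power_mult mult_2)
  qed
qed

section \<open>Bertrand's postulate for large n\<close>

lemma prod_le_power_card:
  fixes f :: "'a \<Rightarrow> nat"
  assumes "\<And>i. i \<in> S \<Longrightarrow> f i \<le> c" "card S \<le> s" "c > 0"
  shows "prod f S \<le> c ^ s"
proof -
  have "prod f S \<le> (\<Prod>i\<in>S. c)" using assms by (intro prod_mono) auto
  also have "\<dots> \<le> c ^ s" using assms by (simp add: power_increasing)
  finally show ?thesis .
qed

text \<open>The prime factors are split at \<open>sqrt (2 * n)\<close>. There are at most
  \<open>sqrt (2 * n)\<close> small ones, each contributing a prime power of at most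
  \<open>2 * n\<close>. The large ones have exponent 1 and avoid both \<open>(2n/3, n]\<close> and
  \<open>(n, 2n]\<close>, so the primorial bound at \<open>2 * n div 3\<close> covers them.\<close>

lemma central_binomial_le_no_primes:
  fixes n :: nat
  assumes "n \<ge> 2" and no_prime: "\<And>p. prime p \<Longrightarrow> n < p \<Longrightarrow> p \<le> 2 * n \<Longrightarrow> False"
  shows "(2 * n) choose n \<le> (2 * n) ^ nat \<lfloor>sqrt (2 * n)\<rfloor> * 4 ^ (2 * n div 3)"
proof -
  let ?C = "(2 * n) choose n" and ?s = "nat \<lfloor>sqrt (2 * n)\<rfloor>"
  define P where "P = prime_factors ?C"
  define S where "S = {p \<in> P. p * p \<le> 2 * n}"
  define L where "L = {p \<in> P. \<not> p * p \<le> 2 * n}"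
  have prime: "prime p" if "p \<in> P" for p using that by (auto simp: P_def)
  have mult: "multiplicity p ?C > 0" if "p \<in> P" for p
    using that by (simp add: P_def prime_factors_multiplicity)
  have pow_le: "p ^ multiplicity p ?C \<le> 2 * n" if "p \<in> P" for p
    using power_multiplicity_central_binomial_le[OF prime[OF that]] assms(1) by simp
  have fin: "finite S" "finite L" by (auto simp: S_def L_def P_def)
  have "?C = (\<Prod>p\<in>P. p ^ multiplicity p ?C)"
    unfolding P_def by (intro prime_factorization_nat) simp
  also have "P = S \<union> L" by (auto simp: S_def L_def)
  also have "(\<Prod>p\<in>S \<union> L. p ^ multiplicity p ?C) =
      (\<Prod>p\<in>S. p ^ multiplicity p ?C) * (\<Prod>p\<in>L. p ^ multiplicity p ?C)"
    using fin by (intro prod.union_disjoint) (auto simp: S_def L_def)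
  also have "(\<Prod>p\<in>S. p ^ multiplicity p ?C) \<le> (2 * n) ^ ?s"
  proof (rule prod_le_power_card)
    have "S \<subseteq> {1..?s}"
    proof
      fix p assume p: "p \<in> S"
      then have "real p * real p \<le> 2 * n" by (simp add: S_def flip: of_nat_mult)
      then have "real p \<le> sqrt (2 * n)" by (intro real_le_rsqrt) (simp add: power2_eq_square)
      moreover have "p \<ge> 1" using p prime prime_ge_1_nat by (auto simp: S_def)
      ultimately show "p \<in> {1..?s}" by (simp add: le_nat_floor)
    qed
    from card_mono[OF _ this] show "card S \<le> ?s" by simp
  qed (use assms pow_le in \<open>auto simp: S_def\<close>)
  also have "(\<Prod>p\<in>L. p ^ multiplicity p ?C) \<le> \<Prod>{p. prime p \<and> p \<le> 2 * n div 3}"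
  proof -
    have L: "multiplicity p ?C = 1 \<and> p \<le> 2 * n div 3" if "p \<in> L" for p
    proof
      have p: "p \<in> P" "prime p" "p > 1" "p ^ 2 > 2 * n"
        using that prime prime_gt_1_nat by (auto simp: L_def power2_eq_square)
      then have "p ^ multiplicity p ?C < p ^ 2" using pow_le[of p] by linarith
      then have "multiplicity p ?C < 2" using p power_less_imp_less_exp by blast
      then show "multiplicity p ?C = 1" using mult[OF p(1)] by simp
      have "p ^ 1 \<le> p ^ multiplicity p ?C" using p mult[OF p(1)] by (intro power_increasing) auto
      then have "p \<le> n" using no_prime[OF p(2)] pow_le[OF p(1)] by force
      \<comment> \<open>Excluding 2 supplies the condition \<open>p \<ge> 3\<close> of the vanishing
        lemma.\<close>
      moreover have "p \<noteq> 2" using p(4) assms(1) by auto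
      ultimately have "\<not> 2 * n < 3 * p"
        using multiplicity_central_binomial_eq_0[OF p(2)] mult[OF p(1)] p(3) by force
      then show "p \<le> 2 * n div 3" by simp
    qed
    then have "(\<Prod>p\<in>L. p ^ multiplicity p ?C) = \<Prod>L" by (intro prod.cong) auto
    also have "\<dots> dvd \<Prod>{p. prime p \<and> p \<le> 2 * n div 3}"
      using L prime by (intro prod_dvd_prod_subset) (auto simp: L_def)
    finally show ?thesis
      by (intro dvd_imp_le) (auto intro!: prod_pos prime_gt_0_nat)
  qed
  also have "\<dots> \<le> 4 ^ (2 * n div 3)" by (rule primorial_le)
  finally show ?thesis by simp
qed

text \<open>Without such a prime, the upper bound contradicts
  \<open>4 ^ n \<le> 2 * n * ((2 * n) choose n)\<close>: the spare factor
  \<open>4 powr (n / 3)\<close> eventually outgrows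
  \<open>2 * n * (2 * n) powr sqrt (2 * n)\<close>.\<close>

lemma eventually_prime_between:
  "eventually (\<lambda>n. \<exists>p. prime p \<and> n < p \<and> p \<le> 2 * n) (sequentially :: nat filter)"
proof -
  have "eventually (\<lambda>x::real. 2 * x * ((2 * x) powr sqrt (2 * x) * 4 powr (2 * x / 3)) < 4 powr x) at_top"
    by real_asymp
  then have "eventually (\<lambda>n. 2 * real n * ((2 * real n) powr sqrt (2 * real n) * 4 powr (2 * real n / 3)) < 4 powr real n) sequentially"
    by (rule eventually_nat_real)
  then show ?thesis
    using eventually_ge_at_top[of 2]
  proof eventually_elim
    case (elim n)
    show ?case
    proof (rule ccontr)
      assume "\<not> ?thesis"
      then have le: "(2 * n) choose n \<le> (2 * n) ^ nat \<lfloor>sqrt (2 * n)\<rfloor> * 4 ^ (2 * n div 3)"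
        using elim by (intro central_binomial_le_no_primes) auto
      have powr_eq: "(2 * real n) powr real (nat \<lfloor>sqrt (2 * n)\<rfloor>) = (2 * real n) ^ nat \<lfloor>sqrt (2 * n)\<rfloor>"
          "4 powr real (2 * n div 3) = 4 ^ (2 * n div 3)"
        using elim by (intro powr_realpow; simp)+
      have "4 powr real n = 4 ^ n" by (simp add: powr_realpow)
      also have "\<dots> \<le> 2 * real n * real ((2 * n) choose n)"
        using central_binomial_lower_bound[of n] elim by (simp add: field_simps)
      also have "\<dots> \<le> 2 * real n * real ((2 * n) ^ nat \<lfloor>sqrt (2 * n)\<rfloor> * 4 ^ (2 * n div 3))"
        by (intro mult_left_mono of_nat_mono[OF le]) simp
      also have "\<dots> = 2 * real n * ((2 * real n) powr nat \<lfloor>sqrt (2 * n)\<rfloor> * 4 powr (2 * n div 3))"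
        unfolding powr_eq by simp
      also have "\<dots> \<le> 2 * real n * ((2 * real n) powr sqrt (2 * real n) * 4 powr (2 * real n / 3))"
        using elim of_nat_div_le_of_nat[of "2 * n" 3, where 'a = real] by (intro mult_left_mono mult_mono powr_mono) auto
      finally show False using elim by simp
    qed
  qed
qed

section \<open>Prime exponents of double factorials\<close>

lemma double_fact_pos: "double_fact m > 0"
  unfolding double_fact_def by (intro prod_pos) auto

lemma double_fact_1: "double_fact 1 = 1"
  by (simp add: double_fact_def cong: conj_cong)

lemma double_fact_add_2: "double_fact (m + 2) = (m + 2) * double_fact m"
proof -
  have "{k \<in> {1..m + 2}. even k \<longleftrightarrow> even (m + 2)} = insert (m + 2) {k \<in> {1..m}. even k \<longleftrightarrow> even m}"
    by (auto simp: le_Suc_eq)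
  then show ?thesis unfolding double_fact_def by simp
qed

text \<open>The largest \<open>k\<close> such that \<open>k\<close> (for odd \<open>m\<close>) or \<open>2 k\<close> (for even \<open>m\<close>) is a factor of \<open>m!!\<close>.\<close>

definition half_if_even :: "nat \<Rightarrow> nat" where
  "half_if_even m = (if even m then m div 2 else m)"

text \<open>A factor of \<open>m!!\<close> divisible by the odd prime \<open>p\<close> is
  \<open>p * c\<close> with \<open>c\<close> of the parity of \<open>m\<close>. The size bound gives
  \<open>c < 4\<close> for even and \<open>c < 2\<close> for odd \<open>m\<close>, so only
  \<open>?q\<close> can occur, and it contains \<open>p\<close> exactly once.\<close>

lemma multiplicity_double_fact:
  fixes p m :: nat
  assumes "prime p" "odd p" "half_if_even m < 2 * p"
  shows "multiplicity p (double_fact m) = (if p \<le> half_if_even m then 1 else 0)"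
proof -
  let ?S = "{k \<in> {1..m}. even k \<longleftrightarrow> even m}" and ?q = "if even m then 2 * p else p"
  have p: "p > 0" using assms(1) prime_gt_0_nat by blast
  have "multiplicity p k = (if k = ?q then 1 else 0)" if k: "k \<in> ?S" for k
  proof (cases "p dvd k")
    case True
    then obtain c where c: "k = p * c" by blast
    have "c > 0" using k c by (cases c) auto
    have "even c \<longleftrightarrow> even m" using k c assms(2) by auto
    have "p * c \<le> m" using k c by simp
    also have "m < p * (if even m then 4 else 2)"
      using assms(3) by (auto simp: half_if_even_def split: if_splits)
    finally have "p * c < p * (if even m then 4 else 2)" .
    then have "c < (if even m then 4 else 2)" using p by simp
    with \<open>c > 0\<close> \<open>even c \<longleftrightarrow> even m\<close> have c_eq: "c = (if even m then 2 else 1)"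
      by (auto split: if_splits)
    then have "\<not> p dvd c" using assms(1,2) primes_dvd_imp_eq[of p 2] prime_gt_1_nat[of p] by auto
    then have "multiplicity p k = 1"
      using c assms(1) p \<open>c > 0\<close> by (simp add: prime_elem_multiplicity_mult_distrib not_dvd_imp_multiplicity_0)
    moreover have "k = ?q" using c c_eq by simp
    ultimately show ?thesis by simp
  next
    case False
    then have "k \<noteq> ?q" by auto
    with False show ?thesis by (simp add: not_dvd_imp_multiplicity_0)
  qed
  moreover have "multiplicity p (double_fact m) = (\<Sum>k\<in>?S. multiplicity p k)"
    unfolding double_fact_def using assms(1) by (intro prime_elem_multiplicity_prod_distrib) auto
  ultimately have "multiplicity p (double_fact m) = (if ?q \<in> ?S then 1 else 0)" by simp
  also have "?q \<in> ?S \<longleftrightarrow> p \<le> half_if_even m"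
    using p assms(2) by (auto simp: half_if_even_def)
  finally show ?thesis .
qed

section \<open>Passage to natural numbers and finiteness for \<open>d > r\<close>\<close>

text \<open>Used with \<open>c\<close> as the absolute value of \<open>b\<close>: prime exponents
  are then computed in the naturals, and signs are treated separately.\<close>

definition solution_lhs :: "nat \<Rightarrow> nat \<Rightarrow> (nat \<Rightarrow> nat) \<Rightarrow> (nat \<Rightarrow> nat) \<Rightarrow> nat" where
  "solution_lhs c r A n = c * (\<Prod>i=1..r. double_fact (n i) * A i ^ n i)"

lemma solutions_bounded:
  fixes c r d :: nat and A :: "nat \<Rightarrow> nat"
  assumes "c > 0" and "d > r" and A: "\<And>i. i \<in> {1..r} \<Longrightarrow> A i > 0"
  obtains M where "\<And>n y i. solution_lhs c r A n = y ^ d \<Longrightarrow> i \<in> {1..r} \<Longrightarrow> n i \<le> M"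
proof -
  obtain N where N: "\<And>k::nat. k \<ge> N \<Longrightarrow> \<exists>p. prime p \<and> k < p \<and> p \<le> 2 * k"
    using eventually_prime_between unfolding eventually_sequentially by blast
  \<comment> \<open>A prime above \<open>K\<close> is odd and exceeds \<open>c\<close> and every
    \<open>A i\<close>; from \<open>K\<close> on, Bertrand's postulate applies.\<close>
  define K where "K = N + 2 + c + (\<Sum>i=1..r. A i)"
  \<comment> \<open>The factor 4 allows for two halvings: in \<open>half_if_even\<close> and in
    \<open>x div 2\<close>.\<close>
  have "n i \<le> 4 * K + 2" if eq: "solution_lhs c r A n = y ^ d" and i: "i \<in> {1..r}" for n y i
  proof (rule ccontr)
    assume "\<not> ?thesis"
    then have "half_if_even (n i) \<ge> 2 * K" by (auto simp: half_if_even_def)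
    define x where "x = Max ((\<lambda>i. half_if_even (n i)) ` {1..r})"
    have le_x: "half_if_even (n j) \<le> x" if "j \<in> {1..r}" for j
      unfolding x_def using that by (intro Max_ge) auto
    have "x \<in> (\<lambda>i. half_if_even (n i)) ` {1..r}"
      unfolding x_def using i by (intro Max_in) auto
    then obtain j where j: "j \<in> {1..r}" "x = half_if_even (n j)" by blast
    have "x div 2 \<ge> K" using le_x[OF i] \<open>half_if_even (n i) \<ge> 2 * K\<close> by linarith
    then obtain p where p: "prime p" "x div 2 < p" "p \<le> 2 * (x div 2)"
      using N[of "x div 2"] unfolding K_def by auto
    then have "x < 2 * p" "p \<le> x" "p > K" using \<open>x div 2 \<ge> K\<close> by linarith+
    have "odd p" using p(1) \<open>p > K\<close> primes_dvd_imp_eq[of 2 p] by (auto simp: K_def)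
    have p_c: "multiplicity p c = 0"
      using \<open>p > K\<close> assms(1) by (intro not_dvd_imp_multiplicity_0) (auto simp: K_def dest: dvd_imp_le)
    have p_A: "multiplicity p (A k) = 0" if "k \<in> {1..r}" for k
    proof (intro not_dvd_imp_multiplicity_0 notI)
      assume "p dvd A k"
      then have "p \<le> A k" using A[OF that] by (rule dvd_imp_le)
      also have "\<dots> \<le> (\<Sum>i=1..r. A i)" using that by (intro member_le_sum) auto
      finally show False using \<open>p > K\<close> by (simp add: K_def)
    qed
    have pos: "double_fact (n k) * A k ^ n k \<noteq> 0" if "k \<in> {1..r}" for k
      using A[OF that] double_fact_pos[of "n k"] by simp
    have "multiplicity p (solution_lhs c r A n) =
        multiplicity p c + multiplicity p (\<Prod>i=1..r. double_fact (n i) * A i ^ n i)"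
      unfolding solution_lhs_def using p(1) assms(1) pos
      by (intro prime_elem_multiplicity_mult_distrib) auto
    also have "\<dots> = (\<Sum>i=1..r. multiplicity p (double_fact (n i) * A i ^ n i))"
    proof -
      have "0 \<notin> (\<lambda>i. double_fact (n i) * A i ^ n i) ` {1..r}"
        by (rule notI) (erule imageE, drule pos, simp)
      then show ?thesis using p(1) p_c by (simp add: prime_elem_multiplicity_prod_distrib)
    qed
    also have "\<dots> = (\<Sum>k=1..r. if p \<le> half_if_even (n k) then 1 else 0)"
    proof (intro sum.cong refl)
      fix k assume k: "k \<in> {1..r}"
      have "multiplicity p (double_fact (n k) * A k ^ n k) =
          multiplicity p (double_fact (n k)) + n k * multiplicity p (A k)"
        using p(1) pos[OF k] A[OF k]
        by (simp add: prime_elem_multiplicity_mult_distrib prime_elem_multiplicity_power_distrib)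
      also have "\<dots> = (if p \<le> half_if_even (n k) then 1 else 0)"
        using multiplicity_double_fact[OF p(1) \<open>odd p\<close>, of "n k"] le_x[OF k] \<open>x < 2 * p\<close> p_A[OF k]
        by simp
      finally show "multiplicity p (double_fact (n k) * A k ^ n k) = (if p \<le> half_if_even (n k) then 1 else 0)" .
    qed
    also have "\<dots> = card {k \<in> {1..r}. p \<le> half_if_even (n k)}"
      by (simp add: sum.If_cases Int_def)
    finally have mult: "multiplicity p (solution_lhs c r A n) = card {k \<in> {1..r}. p \<le> half_if_even (n k)}" .
    have "card {k \<in> {1..r}. p \<le> half_if_even (n k)} \<le> card {1..r}"
      by (intro card_mono) auto
    moreover have "j \<in> {k \<in> {1..r}. p \<le> half_if_even (n k)}"
      using j \<open>p \<le> x\<close> by auto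
    then have "card {k \<in> {1..r}. p \<le> half_if_even (n k)} > 0" by (auto simp: card_gt_0_iff)
    \<comment> \<open>This includes \<open>y = 0\<close>, where the multiplicity is 0 by
      convention.\<close>
    moreover have "d dvd multiplicity p (y ^ d)"
    proof (cases "y = 0")
      case False
      then show ?thesis using p(1) by (simp add: prime_elem_multiplicity_power_distrib)
    qed (use assms(2) in \<open>auto simp: power_0_left\<close>)
    ultimately show False using mult eq assms(2) by (auto dest!: dvd_imp_le)
  qed
  then show ?thesis using that by blast
qed

lemma solution_lhs_eq_power:
  assumes "b * (\<Prod>i=1..r. int (double_fact (n i)) * int (A i) ^ n i) = x ^ d"
  shows "solution_lhs (nat \<bar>b\<bar>) r A n = nat \<bar>x\<bar> ^ d"
proof -
  have "int (solution_lhs (nat \<bar>b\<bar>) r A n) = \<bar>b * (\<Prod>i=1..r. int (double_fact (n i)) * int (A i) ^ n i)\<bar>"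
    by (simp add: solution_lhs_def abs_mult abs_prod power_abs)
  also have "\<dots> = int (nat \<bar>x\<bar> ^ d)" unfolding assms by (simp add: power_abs)
  finally show ?thesis by (simp only: of_nat_eq_iff)
qed

lemma finite_solutions:
  assumes "b \<noteq> 0" and "d > r" and A: "\<And>i. i \<in> {1..r} \<Longrightarrow> A i > 0"
  shows "finite (solutions b r A d)"
proof -
  obtain M where M: "\<And>n y i. solution_lhs (nat \<bar>b\<bar>) r A n = y ^ d \<Longrightarrow> i \<in> {1..r} \<Longrightarrow> n i \<le> M"
    using solutions_bounded[of "nat \<bar>b\<bar>" r d A] assms by auto
  let ?F = "{1..r} \<rightarrow>\<^sub>E {..M}"
  let ?c = "\<lambda>n. int (solution_lhs (nat \<bar>b\<bar>) r A n)"
  \<comment> \<open>For each tuple \<open>n\<close>, \<open>x\<close> is confined to a finite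
    interval, as \<open>d \<ge> 1\<close> makes \<open>\<bar>x\<bar>\<close> at most its
    \<open>d\<close>-th power.\<close>
  have "solutions b r A d \<subseteq> (\<Union>n\<in>?F. {-?c n..?c n} \<times> {n})"
  proof safe
    fix x n assume "(x, n) \<in> solutions b r A d"
    then have n: "n \<in> {1..r} \<rightarrow>\<^sub>E {1..}" and lhs: "solution_lhs (nat \<bar>b\<bar>) r A n = nat \<bar>x\<bar> ^ d"
      by (auto simp: solutions_def intro: solution_lhs_eq_power)
    have "n \<in> ?F" using n M[OF lhs] by (auto simp: PiE_iff)
    moreover have "nat \<bar>x\<bar> \<le> nat \<bar>x\<bar> ^ d"
      using assms(2) by (cases "x = 0") (auto intro: self_le_power)
    then have "\<bar>x\<bar> \<le> ?c n" unfolding lhs by linarith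
    ultimately show "(x, n) \<in> (\<Union>n\<in>?F. {-?c n..?c n} \<times> {n})"
      by (auto simp: abs_le_iff)
  qed
  moreover have "finite (\<Union>n\<in>?F. {-?c n..?c n} \<times> {n})"
    by (intro finite_UN_I finite_PiE) auto
  ultimately show ?thesis by (rule finite_subset)
qed

section \<open>Infinitely many solutions for \<open>d \<le> r\<close>\<close>

lemma infinite_lhs_powers:
  fixes c r d :: nat and A :: "nat \<Rightarrow> nat"
  assumes "c > 0" "d \<ge> 1" "d \<le> r" and A: "\<And>i. i \<in> {1..r} \<Longrightarrow> A i > 0"
  shows "infinite {n \<in> {1..r} \<rightarrow>\<^sub>E {1..}. \<exists>y. solution_lhs c r A n = y ^ d}"
proof -
  define B where "B = c * (\<Prod>i\<in>{d<..r}. A i)"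
  define Q where "Q = (\<Prod>i\<in>{1<..d}. A i)"
  have pos: "B > 0" "Q > 0"
    using assms by (auto simp: B_def Q_def intro!: prod_pos)
  (* B ^ (d - 1) completes the coefficient B to a d-th power, and Q ^ 2 raises Q ^ (N - 2) to Q ^ N,
     which is a d-th power since d dvd N; the shift t + 3 keeps N - 2 positive. *)
  define N where "N t = B ^ (d - 1) * Q ^ 2 * (d * (t + 3)) ^ d" for t
  define n where "n t = (\<lambda>i\<in>{1..r}. if i = 1 then N t else if i \<le> d then N t - 2 else 1)" for t
  have N_ge: "N t \<ge> t + 3" for t
  proof -
    have "1 * (t + 3) \<le> d * (t + 3)" using assms(2) by (intro mult_right_mono) auto
    also have "\<dots> \<le> (d * (t + 3)) ^ d" using assms(2) by (intro self_le_power) auto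
    also have "\<dots> \<le> (B ^ (d - 1) * Q ^ 2) * (d * (t + 3)) ^ d" using pos by simp
    finally show ?thesis by (simp add: N_def)
  qed
  have "n t \<in> {1..r} \<rightarrow>\<^sub>E {1..}" for t
    using N_ge[of t] by (auto simp: n_def)
  moreover have "\<exists>y. solution_lhs c r A (n t) = y ^ d" for t
  proof -
    obtain m where m: "N t = m + 2" using le_Suc_ex[of 2 "N t"] N_ge[of t] by (auto simp: add.commute)
    have "d dvd (d * (t + 3)) ^ d" using assms(2) by (intro dvd_power_le[of d _ 1 d, simplified]) auto
    then have "d dvd N t" unfolding N_def by simp
    \<comment> \<open>This turns \<open>A 1 ^ N t\<close> and \<open>Q ^ N t\<close> into
      \<open>d\<close>-th powers of \<open>A 1 ^ k\<close> and \<open>Q ^ k\<close>.\<close>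
    then obtain k where k: "N t = k * d" by (metis dvd_def mult.commute)
    define g where "g i = double_fact (n t i) * A i ^ n t i" for i
    have g1: "g 1 = (m + 2) * double_fact m * A 1 ^ N t"
    proof -
      have "n t 1 = m + 2" using assms m by (simp add: n_def)
      then show ?thesis by (simp only: g_def double_fact_add_2 m)
    qed
    have "{1..r} = insert 1 ({1<..d} \<union> {d<..r})" using assms by auto
    then have "prod g {1..r} = prod g (insert 1 ({1<..d} \<union> {d<..r}))" by simp
    also have "\<dots> = g 1 * (prod g {1<..d} * prod g {d<..r})"
      using assms(2) by (simp add: prod.union_disjoint)
    also have "prod g {1<..d} = (\<Prod>i\<in>{1<..d}. double_fact m * A i ^ m)"
      using assms m by (intro prod.cong) (auto simp: g_def n_def)
    also have "\<dots> = double_fact m ^ (d - 1) * Q ^ m"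
      by (simp add: prod.distrib Q_def flip: prod_power_distrib)
    also have "prod g {d<..r} = (\<Prod>i\<in>{d<..r}. A i)"
      using assms double_fact_1 by (intro prod.cong) (auto simp: g_def n_def)
    finally have prod: "prod g {1..r} = g 1 * (double_fact m ^ (d - 1) * Q ^ m * (\<Prod>i\<in>{d<..r}. A i))" .
    have "solution_lhs c r A (n t) = c * prod g {1..r}"
      by (simp add: solution_lhs_def g_def)
    \<comment> \<open>The \<open>double_fact m\<close> split off from \<open>g 1\<close> joins the
      \<open>d - 1\<close> copies from the indices \<open>2\<close> to \<open>d\<close>.\<close>
    also have "\<dots> =
        B * (double_fact m * double_fact m ^ (d - 1)) * (N t * A 1 ^ N t * Q ^ m)"
      by (simp only: prod g1 B_def m ac_simps)
    also have "double_fact m * double_fact m ^ (d - 1) = double_fact m ^ d"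
      using assms(2) by (simp flip: power_Suc)
    also have "B * double_fact m ^ d * (N t * A 1 ^ N t * Q ^ m) =
        (B * B ^ (d - 1)) * double_fact m ^ d * (d * (t + 3)) ^ d * (A 1 ^ N t * (Q ^ 2 * Q ^ m))"
      unfolding N_def by (simp add: ac_simps)
    also have "B * B ^ (d - 1) = B ^ d"
      using assms(2) by (simp flip: power_Suc)
    also have "Q ^ 2 * Q ^ m = Q ^ N t"
      by (simp add: m power_add power2_eq_square)
    also have "B ^ d * double_fact m ^ d * (d * (t + 3)) ^ d * (A 1 ^ N t * Q ^ N t) =
        (B * double_fact m * (d * (t + 3)) * (A 1 * Q) ^ k) ^ d"
      by (simp only: k power_mult_distrib power_mult)
    finally show ?thesis by blast
  qed
  ultimately have "range n \<subseteq> {n \<in> {1..r} \<rightarrow>\<^sub>E {1..}. \<exists>y. solution_lhs c r A n = y ^ d}"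
    by blast
  moreover have "inj n"
  proof (rule injI)
    fix s t assume "n s = n t"
    then have "n s 1 = n t 1" by simp
    then have "N s = N t" using assms by (simp add: n_def)
    then have "(d * (s + 3)) ^ d = (d * (t + 3)) ^ d" using pos by (simp add: N_def)
    then have "d * (s + 3) = d * (t + 3)" by (rule power_eq_imp_eq_base) (use assms in auto)
    then show "s = t" using assms by simp
  qed
  then have "infinite (range n)" using finite_imageD by blast
  ultimately show ?thesis using finite_subset by blast
qed

text \<open>The sign is restored by taking \<open>x = sgn b * y\<close>: since \<open>b > 0\<close>
  or \<open>d\<close> is odd, \<open>sgn b\<close> is its own \<open>d\<close>-th power. Infinitely
  many tuples \<open>n\<close> then occur as second components.\<close>

lemma infinite_solutions:
  assumes "b \<noteq> 0" "d \<ge> 1" "d \<le> r" and A: "\<And>i. i \<in> {1..r} \<Longrightarrow> A i > 0" and "\<not> (b < 0 \<and> even d)"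
  shows "infinite (solutions b r A d)"
proof
  assume "finite (solutions b r A d)"
  then have fin: "finite (snd ` solutions b r A d)" by simp
  have "{n \<in> {1..r} \<rightarrow>\<^sub>E {1..}. \<exists>y. solution_lhs (nat \<bar>b\<bar>) r A n = y ^ d} \<subseteq> snd ` solutions b r A d"
  proof safe
    fix n y assume n: "n \<in> {1..r} \<rightarrow>\<^sub>E {1..}" and y: "solution_lhs (nat \<bar>b\<bar>) r A n = y ^ d"
    have "int (solution_lhs (nat \<bar>b\<bar>) r A n) = \<bar>b\<bar> * (\<Prod>i=1..r. int (double_fact (n i)) * int (A i) ^ n i)"
      by (simp add: solution_lhs_def)
    then have abs: "\<bar>b\<bar> * (\<Prod>i=1..r. int (double_fact (n i)) * int (A i) ^ n i) = int y ^ d"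
      using y by simp
    have "b * (\<Prod>i=1..r. int (double_fact (n i)) * int (A i) ^ n i) = sgn b * (int y ^ d)"
      unfolding abs[symmetric] mult.assoc[symmetric] by (simp only: sgn_mult_abs)
    also have "sgn b = sgn b ^ d"
      using assms(1,5) by (cases "b > 0") auto
    finally have "(sgn b * int y, n) \<in> solutions b r A d"
      using n by (simp add: solutions_def power_mult_distrib)
    then show "n \<in> snd ` solutions b r A d" by force
  qed
  then have "finite {n \<in> {1..r} \<rightarrow>\<^sub>E {1..}. \<exists>y. solution_lhs (nat \<bar>b\<bar>) r A n = y ^ d}"
    using fin by (rule finite_subset)
  then show False using infinite_lhs_powers[of "nat \<bar>b\<bar>" d r A] assms by auto
qed

section \<open>Sign obstruction and combination of the cases\<close>

lemma no_solutions:
  assumes "b < 0" "even d" and A: "\<And>i. i \<in> {1..r} \<Longrightarrow> A i > 0"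
  shows "solutions b r A d = {}"
proof -
  have False if "(x, n) \<in> solutions b r A d" for x n
  proof -
    have "(\<Prod>i=1..r. int (double_fact (n i)) * int (A i) ^ n i) > 0"
      using A double_fact_pos by (intro prod_pos) auto
    then have "b * (\<Prod>i=1..r. int (double_fact (n i)) * int (A i) ^ n i) < 0"
      using assms(1) by (simp add: mult_neg_pos)
    moreover have "x ^ d \<ge> 0" using assms(2) by (simp add: zero_le_even_power)
    ultimately show False using that by (simp add: solutions_def)
  qed
  then show ?thesis by auto
qed

theorem theorem1p6:
  fixes b :: int and r d :: nat and A :: "nat \<Rightarrow> nat"
  assumes "b \<noteq> 0" and "r \<ge> 1" and "d \<ge> 1"
    and "\<And>i. i \<in> {1..r} \<Longrightarrow> A i > 0"
  shows "(d > r \<longrightarrow> finite (solutions b r A d)) \<and>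
    (d \<le> r \<longrightarrow>
      (if b < 0 \<and> even d then solutions b r A d = {} else infinite (solutions b r A d)))"
  using finite_solutions[of b r d A] no_solutions[of b d r A] infinite_solutions[of b d r A] assms
  by auto

end
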